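(* Let $X$ be an irreducible reduced hypersurface of degree $d\geq 3$ in $\mathbb{P}^N$ over $\mathbb{C}$, and let $\mathcal{S}$ be the set of $(N-2)$-dimensional linear subspaces $\Lambda$ of $\mathbb{P}^N$ contained in $X$ such that a general element of $\Lambda$ is a star point of $X$. Assume that $\mathcal{S}$ has at least two elements and that there exists a hyperplane $H$ of $\mathbb{P}^N$ such that every $\Lambda\in\mathcal{S}$ is contained in $H$. Then $\mathcal{S}$ has at most $d$ elements.
   Context: The ground field is $\mathbb{C}$. A smooth point $P$ of an irreducible reduced hypersurface $X\subset\mathbb{P}^N$ of degree $d\geq 3$ is called a star point on $X$ if the scheme $T_P(X)\cap X$ is a cone with vertex $P$, where $T_P(X)\subset\mathbb{P}^N$ is the embedded tangent hyperplane to $X$ at $P$; that is, in homogeneous coordinates $(Y_0:\dots:Y_{N-1})$ on $T_P(X)$ with $P=(1:0:\dots:0)$, the scheme $T_P(X)\cap X$ is defined by a form of degree $d$ not involving $Y_0$. "A general element of $\Lambda$" means all points of some nonempty Zariski open subset of $\Lambda$. *)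

theory Defs
  imports
    "HOL-Analysis.Analysis"
    "HOL-Library.Poly_Mapping"
    "HOL-Computational_Algebra.Factorial_Ring"
begin

section \<open>Multivariate polynomials\<close>

text \<open>
  A polynomial over the complex numbers in variables indexed by \<open>'v\<close> is a finitely supported map
  from exponent vectors to coefficients; the ring structure is that of \<^theory>\<open>HOL-Library.Poly_Mapping\<close>.
\<close>

type_synonym 'v cpoly = "('v \<Rightarrow>\<^sub>0 nat) \<Rightarrow>\<^sub>0 complex"

definition mdegree :: "('v \<Rightarrow>\<^sub>0 nat) \<Rightarrow> nat" where
  "mdegree m = (\<Sum>i\<in>Poly_Mapping.keys m. Poly_Mapping.lookup m i)"

definition is_form :: "nat \<Rightarrow> 'v cpoly \<Rightarrow> bool" where
  "is_form d p \<longleftrightarrow> p \<noteq> 0 \<and> (\<forall>m\<in>Poly_Mapping.keys p. mdegree m = d)"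

definition vars :: "'v cpoly \<Rightarrow> 'v set" where
  "vars p = (\<Union>m\<in>Poly_Mapping.keys p. Poly_Mapping.keys m)"

text \<open>The homomorphism that is \<open>h\<close> on coefficients and sends the variable \<open>i\<close> to \<open>s i\<close>.\<close>

definition eval_hom :: "(complex \<Rightarrow> 'r::comm_ring_1) \<Rightarrow> ('v \<Rightarrow> 'r) \<Rightarrow> 'v cpoly \<Rightarrow> 'r" where
  "eval_hom h s p =
     (\<Sum>m\<in>Poly_Mapping.keys p. h (Poly_Mapping.lookup p m) *
        (\<Prod>i\<in>Poly_Mapping.keys m. s i ^ Poly_Mapping.lookup m i))"

definition Const :: "complex \<Rightarrow> 'v cpoly" where
  "Const c = Poly_Mapping.single 0 c"

definition Var :: "'v \<Rightarrow> 'v cpoly" where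
  "Var i = Poly_Mapping.single (Poly_Mapping.single i 1) 1"

definition peval :: "'n::finite cpoly \<Rightarrow> complex ^ 'n \<Rightarrow> complex" where
  "peval p v = eval_hom id (\<lambda>i. v $ i) p"

definition partial_deriv :: "'v \<Rightarrow> 'v cpoly \<Rightarrow> 'v cpoly" where
  "partial_deriv i p =
     (\<Sum>m\<in>Poly_Mapping.keys p.
        Poly_Mapping.single (m - Poly_Mapping.single i 1)
          (of_nat (Poly_Mapping.lookup m i) * Poly_Mapping.lookup p m))"


section \<open>Projective space\<close>

text \<open>
  The projective space is that of \<open>complex ^ 'n\<close>, of dimension \<open>CARD('n) - 1\<close>.
  A point is given by a nonzero vector of homogeneous coordinates; every notion below is invariant
  under rescaling of that vector. Linear subspaces of the projective space are represented
  by linear subspaces of \<open>complex ^ 'n\<close> (a bijective correspondence, the empty projective subspace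
  being \<open>{0}\<close>), and dimensions drop by one.
\<close>

definition proj_subspace :: "int \<Rightarrow> (complex ^ 'n::finite) set \<Rightarrow> bool" where
  "proj_subspace k W \<longleftrightarrow> vec.subspace W \<and> int (vec.dim W) - 1 = k"

definition proj_points :: "(complex ^ 'n::finite) set \<Rightarrow> (complex ^ 'n) set" where
  "proj_points W = W - {0}"

definition hypersurface :: "'n::finite cpoly \<Rightarrow> (complex ^ 'n) set" where
  "hypersurface F = {v. v \<noteq> 0 \<and> peval F v = 0}"

definition zariski_open_in :: "(complex ^ 'n::finite) set \<Rightarrow> (complex ^ 'n) set \<Rightarrow> bool" where
  "zariski_open_in W U \<longleftrightarrow>
     (\<exists>G. (\<forall>g\<in>G. \<exists>e. is_form e g) \<and> U = {v \<in> proj_points W. \<exists>g\<in>G. peval g v \<noteq> 0})"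

definition general_element ::
  "(complex ^ 'n::finite) set \<Rightarrow> (complex ^ 'n \<Rightarrow> bool) \<Rightarrow> bool" where
  "general_element W Q \<longleftrightarrow> (\<exists>U. zariski_open_in W U \<and> U \<noteq> {} \<and> (\<forall>v\<in>U. Q v))"


section \<open>Star points\<close>

text \<open>
  The hypersurface, as a scheme, is represented by its equation \<open>F\<close>; for irreducible and reduced
  hypersurfaces of degree \<open>d\<close>, \<open>F\<close> is an irreducible form of degree \<open>d\<close>.
\<close>

definition smooth_point :: "'n::finite cpoly \<Rightarrow> complex ^ 'n \<Rightarrow> bool" where
  "smooth_point F P \<longleftrightarrow> P \<in> hypersurface F \<and> (\<exists>i. peval (partial_deriv i F) P \<noteq> 0)"

definition tangent_hyperplane :: "'n::finite cpoly \<Rightarrow> complex ^ 'n \<Rightarrow> (complex ^ 'n) set" where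
  "tangent_hyperplane F P = {w. (\<Sum>i\<in>UNIV. peval (partial_deriv i F) P * w $ i) = 0}"

text \<open>
  \<open>b 0, \<dots>, b (k - 1)\<close> is a basis of \<open>T\<close>: the homogeneous coordinates \<open>Y\<^sub>0, \<dots>, Y\<^sub>k\<^sub>-\<^sub>1\<close>
  describe the vector \<open>Y\<^sub>0 b 0 + \<dots> + Y\<^sub>k\<^sub>-\<^sub>1 b (k - 1)\<close>, so that \<open>b 0\<close> is \<open>(1:0:\<dots>:0)\<close>.
\<close>

definition coord_system ::
  "nat \<Rightarrow> (nat \<Rightarrow> complex ^ 'n::finite) \<Rightarrow> (complex ^ 'n) set \<Rightarrow> bool" where
  "coord_system k b T \<longleftrightarrow>
     inj_on b {..<k} \<and> vec.independent (b ` {..<k}) \<and> vec.span (b ` {..<k}) = T"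

text \<open>
  The polynomial in the \<open>Y\<^sub>j\<close> obtained from \<open>F\<close> by substituting the vector above; it is the equation
  of the scheme-theoretic intersection of \<open>T\<close> with the hypersurface, unique up to a nonzero scalar.
\<close>

definition restrict_form ::
  "nat \<Rightarrow> (nat \<Rightarrow> complex ^ 'n::finite) \<Rightarrow> 'n cpoly \<Rightarrow> nat cpoly" where
  "restrict_form k b F = eval_hom Const (\<lambda>i. \<Sum>j<k. Const (b j $ i) * Var j) F"

definition star_point :: "nat \<Rightarrow> 'n::finite cpoly \<Rightarrow> complex ^ 'n \<Rightarrow> bool" where
  "star_point d F P \<longleftrightarrow> smooth_point F P \<and>
     (\<exists>b. coord_system (CARD('n) - 1) b (tangent_hyperplane F P) \<and> b 0 = P \<and>
          is_form d (restrict_form (CARD('n) - 1) b F) \<and>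
          0 \<notin> vars (restrict_form (CARD('n) - 1) b F))"

definition star_subspaces :: "nat \<Rightarrow> nat \<Rightarrow> 'n::finite cpoly \<Rightarrow> (complex ^ 'n) set set" where
  "star_subspaces N d F =
     {W. proj_subspace (int N - 2) W \<and> proj_points W \<subseteq> hypersurface F \<and>
         general_element W (star_point d F)}"

end

(*
  The subspaces in question are hyperplanes of H lying on X, so it suffices that X cuts out
  a hypersurface of degree d in H. If F vanished on H, the linear form defining H would divide F,
  which is impossible for an irreducible form of degree at least 2. So F is nonzero at some v in H,
  and a line in H through v in general direction meets the subspaces in distinct points, which are
  zeros of the restriction of F to this line, a nonzero polynomial of degree at most d.
*)

theory Submission
  imports Defs "HOL-Computational_Algebra.Polynomial"
begin

section \<open>Ring homomorphisms and substitution into polynomials\<close>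

text \<open>A predicate on plain functions, so that the coefficient embeddings \<open>id\<close>,
  \<open>Const\<close> and \<open>\<lambda>c. [:c:]\<close> and the evaluations
  \<open>\<lambda>p. poly p x\<close> and \<open>\<lambda>p. peval p v\<close> are all instances of
  one notion.\<close>

definition ring_hom_map :: "('a::comm_ring_1 \<Rightarrow> 'b::comm_ring_1) \<Rightarrow> bool" where
  "ring_hom_map h \<longleftrightarrow>
     h 0 = 0 \<and> h 1 = 1 \<and> (\<forall>x y. h (x + y) = h x + h y) \<and> (\<forall>x y. h (x * y) = h x * h y)"

lemma ring_hom_map_sum: "ring_hom_map h \<Longrightarrow> h (sum f A) = (\<Sum>i\<in>A. h (f i))"
  by (induction A rule: infinite_finite_induct) (auto simp: ring_hom_map_def)

lemma ring_hom_map_prod: "ring_hom_map h \<Longrightarrow> h (prod f A) = (\<Prod>i\<in>A. h (f i))"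
  by (induction A rule: infinite_finite_induct) (auto simp: ring_hom_map_def)

lemma ring_hom_map_power: "ring_hom_map h \<Longrightarrow> h (x ^ n) = h x ^ n"
  by (induction n) (auto simp: ring_hom_map_def)

lemma ring_hom_map_mult: "ring_hom_map h \<Longrightarrow> h (x * y) = h x * h y"
  by (simp add: ring_hom_map_def)

lemma ring_hom_map_one: "ring_hom_map h \<Longrightarrow> h 1 = 1"
  by (simp add: ring_hom_map_def)

lemma ring_hom_map_diff: "ring_hom_map h \<Longrightarrow> h (x - y) = h x - h y"
  unfolding ring_hom_map_def by (metis add_diff_cancel_right' diff_add_cancel)

lemma ring_hom_map_id: "ring_hom_map id"
  by (simp add: ring_hom_map_def)

lemma ring_hom_map_pCons: "ring_hom_map (\<lambda>c. [:c:])"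
  by (simp add: ring_hom_map_def one_pCons)

lemma ring_hom_map_poly: "ring_hom_map (\<lambda>p. poly p x)"
  by (simp add: ring_hom_map_def)

lemma ring_hom_map_Const: "ring_hom_map Const"
  by (simp add: ring_hom_map_def Const_def mult_single single_add)

text \<open>Updating a map at a key outside its support amounts to adding a \<open>single\<close>.
  For polynomials this reduces additive claims to monomials.\<close>

lemma poly_mapping_single_add_induct [case_names single add]:
  assumes single: "\<And>m c. P (Poly_Mapping.single m c)"
    and add: "\<And>p q. P p \<Longrightarrow> P q \<Longrightarrow> P (p + q)"
  shows "P (p :: 'a \<Rightarrow>\<^sub>0 'b::comm_monoid_add)"
proof (induction p rule: update_induct)
  case const
  show ?case
    using single[of _ 0] by simp
next
  case (update f a b)
  then have "Poly_Mapping.update a b f = Poly_Mapping.single a b + f"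
    by (intro poly_mapping_eqI)
       (auto simp: lookup_update lookup_add lookup_single when_def in_keys_iff)
  with update show ?case
    by (simp add: add single)
qed

text \<open>Extra keys contribute zero coefficients and extra variables contribute factors with
  exponent 0. The freedom in \<open>K\<close> gives \<open>p\<close>, \<open>q\<close> and
  \<open>p + q\<close> a common index set.\<close>

lemma eval_hom_superset:
  fixes p :: "'v::finite cpoly"
  assumes "h 0 = 0" "finite K" "Poly_Mapping.keys p \<subseteq> K"
  shows "eval_hom h s p =
    (\<Sum>m\<in>K. h (Poly_Mapping.lookup p m) * (\<Prod>i\<in>UNIV. s i ^ Poly_Mapping.lookup m i))"
proof -
  have "(\<Prod>i\<in>Poly_Mapping.keys m. s i ^ Poly_Mapping.lookup m i)
      = (\<Prod>i\<in>UNIV. s i ^ Poly_Mapping.lookup m i)" for m :: "'v \<Rightarrow>\<^sub>0 nat"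
    by (rule prod.mono_neutral_left) (auto simp: in_keys_iff)
  then show ?thesis
    unfolding eval_hom_def using assms
    by (auto intro!: sum.mono_neutral_left simp: in_keys_iff)
qed

lemmas eval_hom_UNIV = eval_hom_superset[OF _ finite_keys subset_refl]

lemma eval_hom_add:
  fixes p q :: "'v::finite cpoly"
  assumes h: "ring_hom_map h"
  shows "eval_hom h s (p + q) = eval_hom h s p + eval_hom h s q"
proof -
  have h0: "h 0 = 0" and hadd: "\<And>x y. h (x + y) = h x + h y"
    using h by (auto simp: ring_hom_map_def)
  let ?K = "Poly_Mapping.keys p \<union> Poly_Mapping.keys q"
  have "Poly_Mapping.keys (p + q) \<subseteq> ?K"
    by (rule keys_add)
  then show ?thesis
    using eval_hom_superset[of h ?K "p + q" s, OF h0] eval_hom_superset[of h ?K p s, OF h0]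
      eval_hom_superset[of h ?K q s, OF h0]
    by (simp add: lookup_add hadd distrib_right sum.distrib)
qed

lemma eval_hom_single:
  fixes m :: "'v::finite \<Rightarrow>\<^sub>0 nat"
  assumes "ring_hom_map h"
  shows "eval_hom h s (Poly_Mapping.single m c)
    = h c * (\<Prod>i\<in>UNIV. s i ^ Poly_Mapping.lookup m i)"
proof -
  have "h 0 = 0"
    using assms by (simp add: ring_hom_map_def)
  then show ?thesis
    by (subst eval_hom_superset[where K = "{m}"]) auto
qed

lemma eval_hom_mult_single:
  fixes q :: "'v::finite cpoly"
  assumes h: "ring_hom_map h"
  shows "eval_hom h s (Poly_Mapping.single m c * q)
    = eval_hom h s (Poly_Mapping.single m c) * eval_hom h s q"
proof (induction q rule: poly_mapping_single_add_induct)
  case (single n e)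
  show ?case
    by (simp add: mult_single eval_hom_single[OF h] ring_hom_map_mult[OF h] lookup_add
        power_add prod.distrib)
next
  case (add f g)
  then show ?case
    by (simp add: distrib_left eval_hom_add[OF h])
qed

lemma eval_hom_mult:
  fixes p q :: "'v::finite cpoly"
  assumes h: "ring_hom_map h"
  shows "eval_hom h s (p * q) = eval_hom h s p * eval_hom h s q"
proof (induction p rule: poly_mapping_single_add_induct)
  case (single n e)
  show ?case
    by (rule eval_hom_mult_single[OF h])
next
  case (add f g)
  then show ?case
    by (simp add: distrib_right eval_hom_add[OF h])
qed

lemma ring_hom_map_eval_hom:
  fixes s :: "'v::finite \<Rightarrow> _"
  assumes h: "ring_hom_map h"
  shows "ring_hom_map (eval_hom h s)"
proof -
  have "eval_hom h s 1 = 1"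
    using eval_hom_single[OF h, of s 0 1] h by (simp add: ring_hom_map_def)
  then show ?thesis
    by (simp add: ring_hom_map_def eval_hom_add[OF h] eval_hom_mult[OF h])
       (simp add: eval_hom_def)
qed

lemma comp_eval_hom:
  fixes p :: "'v::finite cpoly"
  assumes "ring_hom_map g"
  shows "g (eval_hom h s p) = eval_hom (\<lambda>c. g (h c)) (\<lambda>i. g (s i)) p"
  unfolding eval_hom_def
  by (simp add: ring_hom_map_sum[OF assms] ring_hom_map_mult[OF assms]
      ring_hom_map_prod[OF assms] ring_hom_map_power[OF assms])

lemma ring_hom_map_peval: "ring_hom_map (\<lambda>p. peval p v)"
  unfolding peval_def by (rule ring_hom_map_eval_hom[OF ring_hom_map_id])

lemma peval_Const [simp]: "peval (Const c) v = c"
  unfolding peval_def Const_def by (simp add: eval_hom_single[OF ring_hom_map_id])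

lemma prod_power_single:
  fixes s :: "'v::finite \<Rightarrow> 'a::comm_ring_1"
  shows "(\<Prod>i\<in>UNIV. s i ^ Poly_Mapping.lookup (Poly_Mapping.single j 1) i) = s j"
proof -
  have "(\<Prod>i\<in>UNIV. s i ^ Poly_Mapping.lookup (Poly_Mapping.single j 1) i)
      = (\<Prod>i\<in>UNIV. if i = j then s i else 1)"
    by (rule prod.cong) (auto simp: lookup_single when_def)
  then show ?thesis
    by simp
qed

lemma peval_Var [simp]: "peval (Var i) v = v $ i"
  unfolding peval_def Var_def
  by (simp only: eval_hom_single[OF ring_hom_map_id] prod_power_single) simp

lemma peval_eval_hom_Const:
  "peval (eval_hom Const s p) v = peval p (\<chi> i. peval (s i) v)"
  by (subst comp_eval_hom[OF ring_hom_map_peval]) (simp add: peval_def[of p] id_def)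

lemma eval_hom_Const_Var:
  fixes p :: "'v::finite cpoly"
  shows "eval_hom Const Var p = p"
proof (induction p rule: poly_mapping_single_add_induct)
  case (single m c)
  have pow: "Var i ^ k = Poly_Mapping.single (Poly_Mapping.single i k) 1" for i :: 'v and k
    by (induction k) (simp_all add: Var_def mult_single flip: single_add)
  have "(\<Prod>i\<in>A. Poly_Mapping.single (f i) (1::complex)) = Poly_Mapping.single (\<Sum>i\<in>A. f i) 1"
    for A :: "'v set" and f :: "'v \<Rightarrow> 'v \<Rightarrow>\<^sub>0 nat"
    by (induction A rule: infinite_finite_induct) (simp_all add: mult_single)
  moreover have "(\<Sum>i\<in>UNIV. Poly_Mapping.single i (Poly_Mapping.lookup m i)) = m"
    by (rule poly_mapping_eqI) (simp add: lookup_sum lookup_single when_def)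
  ultimately show ?case
    by (subst eval_hom_single[OF ring_hom_map_Const]) (simp add: pow Const_def mult_single)
next
  case (add f g)
  then show ?case
    by (simp add: eval_hom_add[OF ring_hom_map_Const])
qed

lemma dvd_mult_diff:
  fixes a :: "'a::comm_ring_1"
  assumes "a dvd x - y" "a dvd x' - y'"
  shows "a dvd x * x' - y * y'"
proof -
  have "x * x' - y * y' = (x - y) * x' + y * (x' - y')"
    by (simp add: algebra_simps)
  then show ?thesis
    using assms by (metis dvd_add dvd_mult dvd_mult2)
qed

text \<open>Congruence modulo \<open>a\<close> is compatible with powers, products and sums, hence
  with substitution. This takes the place of a factor theorem for linear forms.\<close>

lemma dvd_eval_hom_diff:
  fixes s s' :: "'v \<Rightarrow> 'a::comm_ring_1"
  assumes "\<And>i. a dvd s i - s' i"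
  shows "a dvd eval_hom h s p - eval_hom h s' p"
proof -
  have pow: "a dvd s i ^ k - s' i ^ k" for i k
    by (induction k) (auto intro: dvd_mult_diff assms)
  have "a dvd (\<Prod>i\<in>A. s i ^ f i) - (\<Prod>i\<in>A. s' i ^ f i)" for A f
    by (induction A rule: infinite_finite_induct) (auto intro: dvd_mult_diff pow)
  then show ?thesis
    unfolding eval_hom_def sum_subtractf[symmetric] right_diff_distrib[symmetric]
    by (intro dvd_sum dvd_mult)
qed

section \<open>Polynomials as functions\<close>

text \<open>Monomials are distinct characters, hence independent by Artin's argument.\<close>

lemma monomials_independent:
  fixes c :: "('v::finite \<Rightarrow>\<^sub>0 nat) \<Rightarrow> complex"
  assumes "finite K"
    and "\<And>v :: complex ^ 'v. (\<Sum>m\<in>K. c m * (\<Prod>i\<in>UNIV. v $ i ^ Poly_Mapping.lookup m i)) = 0"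
    and "m \<in> K"
  shows "c m = 0"
  using assms
proof (induction K arbitrary: c m rule: finite_induct)
  case empty
  then show ?case by simp
next
  case (insert n K)
  let ?\<chi> = "\<lambda>m (v :: complex ^ 'v). \<Prod>i\<in>UNIV. v $ i ^ Poly_Mapping.lookup m i"
  have \<chi>_mult: "?\<chi> m (\<chi> i. a $ i * v $ i) = ?\<chi> m a * ?\<chi> m v" for m a v
    by (simp add: power_mult_distrib prod.distrib)
  have eq: "c n * ?\<chi> n v + (\<Sum>m\<in>K. c m * ?\<chi> m v) = 0" for v
    using insert.prems(1)[of v] insert.hyps by simp
  \<comment> \<open>The relation at the coordinatewise product of \<open>a\<close> and
    \<open>v\<close>, minus \<open>?\<chi> n a\<close> times the relation at \<open>v\<close>, no
    longer contains the monomial \<open>n\<close>, so the induction hypothesis applies to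
    it.\<close>
  have "(\<Sum>m\<in>K. (c m * (?\<chi> m a - ?\<chi> n a)) * ?\<chi> m v) = 0" for a v
  proof -
    have "(\<Sum>m\<in>K. (c m * (?\<chi> m a - ?\<chi> n a)) * ?\<chi> m v)
        = (\<Sum>m\<in>K. c m * ?\<chi> m (\<chi> i. a $ i * v $ i)) - ?\<chi> n a * (\<Sum>m\<in>K. c m * ?\<chi> m v)"
      unfolding \<chi>_mult by (simp add: algebra_simps sum_subtractf sum_distrib_left)
    also have "\<dots> = - (c n * ?\<chi> n (\<chi> i. a $ i * v $ i)) + ?\<chi> n a * (c n * ?\<chi> n v)"
      using eq[of "\<chi> i. a $ i * v $ i"] eq[of v] by (simp add: add_eq_0_iff)
    also have "\<dots> = 0"
      unfolding \<chi>_mult by simp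
    finally show ?thesis .
  qed
  from insert.IH[OF this] have diff: "c m * (?\<chi> m a - ?\<chi> n a) = 0" if "m \<in> K" for m a
    using that by blast
  have zero: "c m = 0" if m: "m \<in> K" for m
  proof -
    from m insert.hyps have "m \<noteq> n" by blast
    then obtain i where i: "Poly_Mapping.lookup m i \<noteq> Poly_Mapping.lookup n i"
      by (metis poly_mapping_eqI)
    \<comment> \<open>Putting 2 in a coordinate where the exponents of \<open>m\<close> and
      \<open>n\<close> differ, and 1 elsewhere, separates the two characters.\<close>
    define a :: "complex ^ 'v" where "a = (\<chi> j. if j = i then 2 else 1)"
    have "?\<chi> k a = 2 ^ Poly_Mapping.lookup k i" for k
    proof -
      have "?\<chi> k a = (\<Prod>j\<in>UNIV. if j = i then 2 ^ Poly_Mapping.lookup k j else 1)"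
        by (rule prod.cong) (auto simp: a_def)
      then show ?thesis by simp
    qed
    moreover have "(2::complex) ^ Poly_Mapping.lookup m i \<noteq> 2 ^ Poly_Mapping.lookup n i"
    proof
      \<comment> \<open>Taking norms moves the equation to the reals, where the powers of 2 are
        strictly increasing.\<close>
      assume "(2::complex) ^ Poly_Mapping.lookup m i = 2 ^ Poly_Mapping.lookup n i"
      then have "(2::real) ^ Poly_Mapping.lookup m i = 2 ^ Poly_Mapping.lookup n i"
        by (metis norm_power norm_numeral)
      with i show False by simp
    qed
    ultimately show ?thesis
      using diff[OF m, of a] by simp
  qed
  \<comment> \<open>At the all-ones vector every monomial is 1, so only \<open>c n\<close>
    survives.\<close>
  moreover have "c n = 0"
    using eq[of "\<chi> i. 1"] zero by simp
  ultimately show ?case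
    using insert.prems(2) by blast
qed

text \<open>The coefficients of \<open>p\<close> form a linear relation between distinct monomial
  functions. This lets polynomial identities be checked pointwise.\<close>

lemma peval_eq_zero_imp_zero:
  fixes p :: "'v::finite cpoly"
  assumes "\<And>v. peval p v = 0"
  shows "p = 0"
proof -
  have "Poly_Mapping.lookup p m = 0" if "m \<in> Poly_Mapping.keys p" for m
    using assms that
    by (intro monomials_independent[of "Poly_Mapping.keys p" "Poly_Mapping.lookup p"])
       (simp_all add: peval_def eval_hom_UNIV[of id])
  then show ?thesis
    by (metis in_keys_iff keys_eq_empty ex_in_conv)
qed

section \<open>Restriction to lines, homogeneity and units\<close>

text \<open>The restriction of \<open>p\<close> to the affine line \<open>v + t *s u\<close>, kept
  as a polynomial in the parameter t so that its degree and roots can be used.\<close>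

definition line_poly :: "'v::finite cpoly \<Rightarrow> complex ^ 'v \<Rightarrow> complex ^ 'v \<Rightarrow> complex poly" where
  "line_poly p v u = eval_hom (\<lambda>c. [:c:]) (\<lambda>i. [:v $ i, u $ i:]) p"

lemma poly_line_poly: "poly (line_poly p v u) t = peval p (v + t *s u)"
  unfolding line_poly_def
  by (subst comp_eval_hom[OF ring_hom_map_poly]) (simp add: peval_def id_def)

lemma line_poly_mult: "line_poly (p * q) v u = line_poly p v u * line_poly q v u"
  unfolding line_poly_def by (rule eval_hom_mult[OF ring_hom_map_pCons])

lemma line_poly_one: "line_poly 1 v u = 1"
  unfolding line_poly_def
  by (rule ring_hom_map_one[OF ring_hom_map_eval_hom[OF ring_hom_map_pCons]])

lemma mdegree_UNIV:
  fixes m :: "'v::finite \<Rightarrow>\<^sub>0 nat"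
  shows "mdegree m = (\<Sum>i\<in>UNIV. Poly_Mapping.lookup m i)"
  unfolding mdegree_def by (rule sum.mono_neutral_left) (auto simp: in_keys_iff)

text \<open>Each monomial of \<open>F\<close> becomes a product of \<open>d\<close> factors of
  degree at most 1; the degree can drop, for instance where \<open>u $ i\<close> is 0.\<close>

lemma degree_line_poly_le:
  assumes "is_form d F"
  shows "degree (line_poly F v u) \<le> d"
  unfolding line_poly_def eval_hom_def
proof (rule degree_sum_le[OF finite_keys])
  fix m assume m: "m \<in> Poly_Mapping.keys F"
  have "degree ([:v $ i, u $ i:] ^ Poly_Mapping.lookup m i) \<le> Poly_Mapping.lookup m i" for i
    by (rule order_trans[OF degree_power_le]) simp
  then have "(\<Sum>i\<in>Poly_Mapping.keys m. degree ([:v $ i, u $ i:] ^ Poly_Mapping.lookup m i))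
      \<le> mdegree m"
    unfolding mdegree_def by (intro sum_mono)
  moreover have "degree (\<Prod>i\<in>Poly_Mapping.keys m. [:v $ i, u $ i:] ^ Poly_Mapping.lookup m i)
      \<le> (\<Sum>i\<in>Poly_Mapping.keys m. degree ([:v $ i, u $ i:] ^ Poly_Mapping.lookup m i))"
    using degree_prod_sum_le[OF finite_keys] by (simp add: o_def)
  moreover have "mdegree m = d"
    using assms m by (simp add: is_form_def)
  ultimately show "degree ([:Poly_Mapping.lookup F m:] *
      (\<Prod>i\<in>Poly_Mapping.keys m. [:v $ i, u $ i:] ^ Poly_Mapping.lookup m i)) \<le> d"
    by (intro order_trans[OF degree_mult_le]) simp
qed

lemma peval_scale:
  fixes F :: "'v::finite cpoly"
  assumes "is_form d F"
  shows "peval F (t *s v) = t ^ d * peval F v"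
proof -
  have "Poly_Mapping.lookup F m * (\<Prod>i\<in>UNIV. (t * v $ i) ^ Poly_Mapping.lookup m i)
      = t ^ d * (Poly_Mapping.lookup F m * (\<Prod>i\<in>UNIV. v $ i ^ Poly_Mapping.lookup m i))"
    if "m \<in> Poly_Mapping.keys F" for m
  proof -
    have "d = (\<Sum>i\<in>UNIV. Poly_Mapping.lookup m i)"
      using assms that by (simp add: is_form_def flip: mdegree_UNIV)
    then show ?thesis
      by (simp add: power_mult_distrib prod.distrib power_sum)
  qed
  then show ?thesis
    unfolding peval_def eval_hom_UNIV[of id, OF id_apply] sum_distrib_left
    by (intro sum.cong) simp_all
qed

lemma peval_zero_vector:
  assumes "is_form d F" "d > 0"
  shows "peval F 0 = 0"
  using peval_scale[OF assms(1), of 0 0] assms(2) by (simp add: zero_power)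

text \<open>On the line joining 0 to \<open>v\<close> a unit restricts to a unit of the univariate
  polynomial ring, that is, to a constant; the parameters 1 and 0 then give the same value.\<close>

lemma peval_unit:
  fixes G :: "'v::finite cpoly"
  assumes "G dvd 1"
  shows "peval G v = peval G 0"
proof -
  from assms obtain G' where "1 = G * G'" by (elim dvdE)
  then have "line_poly G 0 v * line_poly G' 0 v = 1"
    by (metis line_poly_mult line_poly_one)
  then have "line_poly G 0 v dvd 1"
    by (metis dvd_triv_left)
  then have "degree (line_poly G 0 v) = 0"
    using is_unit_iff_degree not_is_unit_0 by metis
  then obtain c where "line_poly G 0 v = [:c:]"
    by (meson degree_eq_zeroE)
  then have "peval G (0 + 1 *s v) = peval G (0 + 0 *s v)"
    by (simp only: flip: poly_line_poly) simp
  then show ?thesis by simp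
qed

section \<open>Forms vanishing on a hyperplane\<close>

text \<open>By dimension count, \<open>W\<close> together with any vector of \<open>H\<close>
  outside \<open>W\<close> already spans \<open>H\<close>.\<close>

lemma subspace_codim_one_decomp:
  fixes W H :: "('a::field ^ 'n::finite) set"
  assumes W: "vec.subspace W" and H: "vec.subspace H" and "W \<subseteq> H"
    and dim: "vec.dim H = vec.dim W + 1" and z: "z \<in> H" "z \<notin> W" and "h \<in> H"
  shows "\<exists>t. h - t *s z \<in> W"
proof -
  have span_W: "vec.span W = W"
    using W by simp
  have "z \<notin> vec.span W"
    unfolding span_W by (rule z(2))
  then have "vec.dim (vec.span (insert z W)) = vec.dim H"
    using dim by (simp add: vec.dim_insert)
  moreover have "vec.span (insert z W) \<subseteq> H"
    using assms by (intro vec.span_minimal) auto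
  ultimately have "vec.span (insert z W) = H"
    using H by (intro vec.subspace_dim_equal) auto
  with \<open>h \<in> H\<close> show ?thesis
    unfolding vec.span_insert span_W by blast
qed

text \<open>
  The projection \<open>v \<mapsto> v - l(v) z\<close> along \<open>z\<close> onto \<open>H\<close>, where \<open>l\<close> is the linear form
  defining \<open>H\<close> with \<open>l(z) = 1\<close>, is the identity modulo \<open>l\<close>; hence \<open>l\<close> divides any polynomial
  that vanishes on \<open>H\<close>.
\<close>

lemma irreducible_form_not_vanishing_on_hyperplane:
  fixes F :: "'n::finite cpoly"
  assumes F: "is_form d F" "irreducible F" and d: "d \<ge> 2"
    and H: "vec.subspace H" "vec.dim H + 1 = CARD('n)"
  shows "\<exists>v\<in>H. peval F v \<noteq> 0"
proof (rule ccontr)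
  assume "\<not> ?thesis"
  then have van: "peval F v = 0" if "v \<in> H" for v
    using that by blast
  have "H \<noteq> UNIV"
    using H(2) by (auto simp: card_cart_basis)
  then obtain z where z: "z \<notin> H" by blast
  have "\<exists>t. axis i 1 - t *s z \<in> H" for i
    by (rule subspace_codim_one_decomp[where H = UNIV])
       (use H z in \<open>auto simp: card_cart_basis\<close>)
  \<comment> \<open>\<open>c i\<close> is the component of the i-th basis vector along
    \<open>z\<close> modulo \<open>H\<close>, so these are the coefficients of the linear form whose
    kernel is \<open>H\<close>.\<close>
  then obtain c where c: "\<And>i. axis i 1 - c i *s z \<in> H" by metis
  define l :: "'n cpoly" where "l = (\<Sum>i\<in>UNIV. Const (c i) * Var i)"
  have peval_l: "peval l v = (\<Sum>i\<in>UNIV. c i * v $ i)" for v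
    unfolding l_def
    by (simp add: ring_hom_map_sum[OF ring_hom_map_peval] ring_hom_map_mult[OF ring_hom_map_peval])
  have proj: "v - peval l v *s z \<in> H" for v
  proof -
    have "v - peval l v *s z = (\<Sum>i\<in>UNIV. v $ i *s (axis i 1 - c i *s z))"
      unfolding peval_l
      by (subst (1) basis_expansion[symmetric])
         (simp add: vec.scale_right_diff_distrib sum_subtractf vec.scale_sum_left mult.commute)
    then show ?thesis
      using H(1) c by (simp only: vec.subspace_sum vec.subspace_scale)
  qed
  \<comment> \<open>The coordinates of the projection along \<open>z\<close> as polynomials; by
    construction \<open>s i\<close> is congruent to \<open>Var i\<close> modulo
    \<open>l\<close>.\<close>
  define s where "s i = Var i - Const (z $ i) * l" for i
  have "(\<chi> i. peval (s i) v) = v - peval l v *s z" for v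
    by (simp add: vec_eq_iff s_def ring_hom_map_diff[OF ring_hom_map_peval]
        ring_hom_map_mult[OF ring_hom_map_peval])
  then have "peval (eval_hom Const s F) v = peval F (v - peval l v *s z)" for v
    by (simp add: peval_eval_hom_Const)
  then have "eval_hom Const s F = 0"
    using van[OF proj] by (intro peval_eq_zero_imp_zero) simp
  moreover have "l dvd eval_hom Const s F - eval_hom Const Var F"
    by (rule dvd_eval_hom_diff) (simp add: s_def)
  ultimately have "l dvd F"
    by (simp add: eval_hom_Const_Var)
  then obtain G where G: "F = l * G" by (elim dvdE)
  \<comment> \<open>A linear form vanishes at the origin, whereas a unit has no zero.\<close>
  have "\<not> l dvd 1"
  proof
    assume "l dvd 1"
    then obtain l' where "1 = l * l'" by (elim dvdE)
    then have "peval l 0 * peval l' 0 = 1"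
      by (metis ring_hom_map_mult[OF ring_hom_map_peval] ring_hom_map_one[OF ring_hom_map_peval])
    then show False by (simp add: peval_l)
  qed
  with F(2) G have "G dvd 1"
    using irreducibleD by blast
  \<comment> \<open>With \<open>G\<close> a unit, hence constant as a function, \<open>F\<close>
    scales like a linear form. Comparing its values at \<open>2 *s v\<close> and \<open>v\<close>
    contradicts degree \<open>d \<ge> 2\<close> unless \<open>F\<close> vanishes
    identically.\<close>
  then have F_eq: "peval F v = peval l v * peval G 0" for v
    unfolding G by (metis ring_hom_map_mult[OF ring_hom_map_peval] peval_unit)
  have "peval F v = 0" for v
  proof -
    have "2 ^ d * peval F v = 2 * peval F v"
      using F_eq[of "2 *s v"] F_eq[of v]
      by (simp add: peval_scale[OF F(1)] peval_l sum_distrib_left algebra_simps)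
    moreover have "(2::complex) ^ d \<noteq> 2"
    proof
      assume "(2::complex) ^ d = 2"
      then have "(2::real) ^ d = 2 ^ 1"
        by (metis norm_power norm_numeral power_one_right)
      with d show False by (subst (asm) power_inject_exp) auto
    qed
    ultimately show ?thesis by simp
  qed
  then have "F = 0"
    by (rule peval_eq_zero_imp_zero)
  with F(1) show False
    by (simp add: is_form_def)
qed

section \<open>Counting hyperplanes inside a zero locus\<close>

text \<open>When the vector \<open>u\<close> found for the other subspaces falls into the new one
  \<open>B\<close>, start from \<open>w\<close> in \<open>H\<close> outside \<open>B\<close> and
  move in direction \<open>u\<close>. The points \<open>w + t *s u\<close> never enter
  \<open>B\<close>, and each other subspace contains at most one of them because it does not contain
  \<open>u\<close>; an infinite field leaves a good \<open>t\<close>.\<close>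

lemma subspace_avoids_finite_union:
  fixes H :: "('a::field_char_0 ^ 'n::finite) set"
  assumes "finite \<B>" and H: "vec.subspace H"
    and "\<And>B. B \<in> \<B> \<Longrightarrow> vec.subspace B \<and> \<not> H \<subseteq> B"
  shows "\<exists>u\<in>H. \<forall>B\<in>\<B>. u \<notin> B"
  using assms(1,3)
proof (induction \<B> rule: finite_induct)
  case empty
  then show ?case
    using H vec.subspace_0 by blast
next
  case (insert B \<B>)
  then obtain u where u: "u \<in> H" "\<And>C. C \<in> \<B> \<Longrightarrow> u \<notin> C"
    by blast
  show ?case
  proof (cases "u \<in> B")
    case False
    with u show ?thesis by blast
  next
    case True
    obtain w where w: "w \<in> H" "w \<notin> B"
      using insert.prems by blast
    have "finite {t. w + t *s u \<in> C}" if C: "C \<in> \<B>" for C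
    proof -
      have C': "vec.subspace C"
        using insert.prems C by blast
      have uniq: "t = t'" if "w + t *s u \<in> C" "w + t' *s u \<in> C" for t t'
      proof (rule ccontr)
        assume "t \<noteq> t'"
        have "(t - t') *s u = (w + t *s u) - (w + t' *s u)"
          by (simp add: vec.scale_left_diff_distrib)
        then have "(t - t') *s u \<in> C"
          using that C' vec.subspace_diff by metis
        then have "inverse (t - t') *s ((t - t') *s u) \<in> C"
          using C' vec.subspace_scale by blast
        moreover have "inverse (t - t') * (t - t') = 1"
          using \<open>t \<noteq> t'\<close> by simp
        ultimately show False
          using u(2)[OF C] by (simp only: vector_smult_assoc vector_smult_lid)
      qed
      \<comment> \<open>A set with at most one element lies in the singleton of its chosen element,
        also when it is empty.\<close>
      have "{t. w + t *s u \<in> C} \<subseteq> {SOME t. w + t *s u \<in> C}"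
        by (auto intro!: uniq intro: someI)
      then show ?thesis
        using finite_subset by blast
    qed
    then have "finite (\<Union>C\<in>\<B>. {t. w + t *s u \<in> C})"
      using insert.hyps by blast
    then obtain t where t: "t \<notin> (\<Union>C\<in>\<B>. {t. w + t *s u \<in> C})"
      using ex_new_if_finite infinite_UNIV_char_0 by blast
    have "w + t *s u \<notin> B"
    proof
      assume "w + t *s u \<in> B"
      then have "(w + t *s u) - t *s u \<in> B"
        using True insert.prems by (intro vec.subspace_diff vec.subspace_scale) auto
      with w show False by simp
    qed
    moreover have "w + t *s u \<in> H"
      using H u(1) w(1) by (intro vec.subspace_add vec.subspace_scale)
    ultimately show ?thesis
      using t by blast
  qed
qed

text \<open>General direction means avoiding every \<open>W\<close>, so that the line through
  \<open>v\<close> meets it, and every span of \<open>v\<close> with an intersection of two members,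
  so that no two members are met in the same point.\<close>

lemma card_hyperplanes_in_zero_locus_le:
  fixes F :: "'n::finite cpoly"
  assumes F: "is_form d F" "peval F v \<noteq> 0" "v \<in> H" and H: "vec.subspace H"
    and fin: "finite \<W>"
    and \<W>: "\<And>W. W \<in> \<W> \<Longrightarrow> vec.subspace W \<and> W \<subseteq> H \<and> vec.dim H = vec.dim W + 1
      \<and> (\<forall>w\<in>W. peval F w = 0)"
  shows "card \<W> \<le> d"
proof -
  have v_notin: "v \<notin> W" if "W \<in> \<W>" for W
    using F(2) \<W>[OF that] by blast
  define joins where
    "joins = (\<lambda>(W, W'). vec.span (insert v (W \<inter> W'))) ` {(W, W') \<in> \<W> \<times> \<W>. W \<noteq> W'}"
  have "finite {(W, W') \<in> \<W> \<times> \<W>. W \<noteq> W'}"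
    by (rule finite_subset[of _ "\<W> \<times> \<W>"]) (use fin in auto)
  then have "finite (\<W> \<union> joins)"
    using fin by (simp add: joins_def)
  moreover have "vec.subspace B \<and> \<not> H \<subseteq> B" if "B \<in> \<W> \<union> joins" for B
    using that
  proof
    assume "B \<in> \<W>"
    with \<W> v_notin F(3) show ?thesis by blast
  next
    assume "B \<in> joins"
    then obtain W W' where W: "W \<in> \<W>" "W' \<in> \<W>" "W \<noteq> W'"
      and B: "B = vec.span (insert v (W \<inter> W'))"
      by (auto simp: joins_def)
    have sub: "vec.subspace (W \<inter> W')"
      using \<W>[OF W(1)] \<W>[OF W(2)] by (intro vec.subspace_inter) auto
    have "\<not> W \<subseteq> W'"
    proof
      assume "W \<subseteq> W'"
      moreover have "vec.dim W' \<le> vec.dim W"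
        using \<W>[OF W(1)] \<W>[OF W(2)] by linarith
      ultimately have "W = W'"
        using \<W>[OF W(1)] \<W>[OF W(2)] by (intro vec.subspace_dim_equal) auto
      with W(3) show False by simp
    qed
    \<comment> \<open>Distinct members of equal dimension intersect in dimension at most
      \<open>vec.dim W - 1\<close>; adjoining \<open>v\<close> gives at most
      \<open>vec.dim W\<close>, one less than \<open>vec.dim H\<close>.\<close>
    then have "vec.dim (W \<inter> W') < vec.dim W"
      using vec.subspace_dim_equal[OF sub, of W] \<W>[OF W(1)] by force
    moreover have "vec.dim B \<le> vec.dim (W \<inter> W') + 1"
      unfolding B by (simp add: vec.dim_insert)
    ultimately have "vec.dim B < vec.dim H"
      using \<W>[OF W(1)] by linarith
    then have "\<not> H \<subseteq> B"
      using vec.dim_subset[of H B] by (auto simp: not_le)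
    then show ?thesis
      by (simp add: B)
  qed
  ultimately have "\<exists>u\<in>H. \<forall>B\<in>\<W> \<union> joins. u \<notin> B"
    by (intro subspace_avoids_finite_union[OF _ H])
  then obtain u where u: "u \<in> H" "\<And>B. B \<in> \<W> \<union> joins \<Longrightarrow> u \<notin> B"
    by blast
  \<comment> \<open>Since \<open>u\<close> lies outside \<open>W\<close>, it spans \<open>H\<close>
    together with \<open>W\<close>, and \<open>v\<close> can be moved into \<open>W\<close> along
    \<open>u\<close>.\<close>
  have "\<exists>t. v + t *s u \<in> W" if W: "W \<in> \<W>" for W
  proof -
    obtain t where "v - t *s u \<in> W"
      using subspace_codim_one_decomp[of W H u v] \<W>[OF W] H u W F(3) by blast
    then have "v + (- t) *s u \<in> W" by simp
    then show ?thesis by blast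
  qed
  then obtain t where t: "\<And>W. W \<in> \<W> \<Longrightarrow> v + t W *s u \<in> W" by metis
  \<comment> \<open>A shared parameter puts \<open>v + t W *s u\<close> into both members. It is
    nonzero because \<open>v\<close> lies in no member, so dividing by it would place
    \<open>u\<close> in the forbidden span.\<close>
  have "inj_on t \<W>"
  proof (rule inj_onI, rule ccontr)
    fix W W' assume W: "W \<in> \<W>" "W' \<in> \<W>" "t W = t W'" "W \<noteq> W'"
    then have join: "vec.span (insert v (W \<inter> W')) \<in> joins"
      by (force simp: joins_def)
    have "v + t W *s u \<in> vec.span (insert v (W \<inter> W'))"
      using t[OF W(1)] t[OF W(2)] W(3) by (intro vec.span_base) auto
    then have "(v + t W *s u) - v \<in> vec.span (insert v (W \<inter> W'))"
      by (intro vec.span_diff) (auto intro: vec.span_base)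
    then have "inverse (t W) *s (t W *s u) \<in> vec.span (insert v (W \<inter> W'))"
      unfolding add_diff_cancel_left' by (rule vec.span_scale)
    moreover have "t W \<noteq> 0"
      using t[OF W(1)] v_notin[OF W(1)] by auto
    then have "inverse (t W) * t W = 1"
      by simp
    ultimately have "u \<in> vec.span (insert v (W \<inter> W'))"
      by (simp only: vector_smult_assoc vector_smult_lid)
    with u(2) join show False by blast
  qed
  then have "card \<W> = card (t ` \<W>)"
    by (simp add: card_image)
  \<comment> \<open>The value at parameter 0 is \<open>peval F v\<close>, which is nonzero.\<close>
  moreover have nz: "line_poly F v u \<noteq> 0"
    using poly_line_poly[of F v u 0] F(2) by auto
  have "t ` \<W> \<subseteq> {x. poly (line_poly F v u) x = 0}"
    using \<W> t by (auto simp: poly_line_poly)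
  then have "card (t ` \<W>) \<le> card {x. poly (line_poly F v u) x = 0}"
    by (rule card_mono[OF poly_roots_finite[OF nz]])
  moreover have "card {x. poly (line_poly F v u) x = 0} \<le> degree (line_poly F v u)"
    by (rule card_poly_roots_bound[OF nz])
  ultimately show ?thesis
    using degree_line_poly_le[OF F(1), of v u] by linarith
qed

section \<open>The bound for star subspaces\<close>

theorem mainTheorem5:
  fixes F :: "'n::finite cpoly" and N d :: nat
  assumes "CARD('n) = N + 1"
    and "d \<ge> 3"
    and "is_form d F" and "irreducible F"
    and "\<exists>A\<in>star_subspaces N d F. \<exists>B\<in>star_subspaces N d F. A \<noteq> B"
    and "\<exists>H. proj_subspace (int N - 1) H \<and> (\<forall>W\<in>star_subspaces N d F. W \<subseteq> H)"
  shows "finite (star_subspaces N d F) \<and> card (star_subspaces N d F) \<le> d"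
proof -
  obtain H where H: "vec.subspace H" "vec.dim H = N"
    and sub: "\<And>W. W \<in> star_subspaces N d F \<Longrightarrow> W \<subseteq> H"
    using assms(6) by (auto simp: proj_subspace_def)
  obtain v where v: "v \<in> H" "peval F v \<noteq> 0"
    using irreducible_form_not_vanishing_on_hyperplane[of d F H] assms H by auto
  \<comment> \<open>\<open>proj_points\<close> omits the zero vector, while the counting argument
    needs \<open>F\<close> to vanish on the whole linear subspace.\<close>
  have "peval F 0 = 0"
    using peval_zero_vector[OF assms(3)] assms(2) by simp
  then have "vec.subspace W \<and> W \<subseteq> H \<and> vec.dim H = vec.dim W + 1 \<and> (\<forall>w\<in>W. peval F w = 0)"
    if "W \<in> star_subspaces N d F" for W
    using that sub[OF that] H(2)
    by (auto simp: star_subspaces_def proj_subspace_def proj_points_def hypersurface_def)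
  \<comment> \<open>Bounding all finite subfamilies uniformly by \<open>d\<close> yields finiteness
    of the whole family along with its cardinality bound.\<close>
  then have "card \<W> \<le> d" if "\<W> \<subseteq> star_subspaces N d F" "finite \<W>" for \<W>
    using that by (intro card_hyperplanes_in_zero_locus_le[OF assms(3) v(2,1) H(1)]) auto
  then show ?thesis
    by (intro finite_if_finite_subsets_card_bdd) blast
qed

end
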